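(* Consider the multi-shop ski rental problem with $n\ge 1$ shops, renting prices $1=r_1<r_2<\cdots<r_n$ and buying prices $b_1>b_2>\cdots>b_n>0$, with $b_n$ an integer. Let $i\in\arg\min_{j\in\{1,\dots,n\}}\left(r_j+\frac{b_j-r_j}{b_n}\right)$. Then the deterministic online algorithm (without predictions) that chooses shop $i$, rents at shop $i$ for the first $b_n-1$ days and buys at shop $i$ on day $b_n$ is a best deterministic online algorithm, i.e. it attains the minimal competitive ratio among all deterministic online algorithms, and its competitive ratio is $$r_i+\frac{b_i-r_i}{b_n}.$$
   Context: Multi-shop ski rental (MSSR): a skier skis for an unknown positive integer number $x$ of days. There are $n$ shops; shop $j$ rents skis for $r_j$ dollars per day and sells them for $b_j$ dollars. At the very beginning the skier must choose one shop and must then rent or buy only at that shop; the only remaining decision is on which day to buy. Thus a deterministic online algorithm (which does not know $x$) is a choice of a shop $j$ and a buying day $d\in\{1,2,3,\dots\}\cup\{\infty\}$ ($d=\infty$ meaning never buy), and its cost is $\mathrm{ALG}(x)=x\,r_j$ if $x<d$ and $\mathrm{ALG}(x)=(d-1)r_j+b_j$ if $x\ge d$. The offline optimal cost (with $x$ known) is $\mathrm{OPT}(x)=\min\{x,b_n\}$. The competitive ratio of an algorithm is $\sup_{x\ge 1}\mathrm{ALG}(x)/\mathrm{OPT}(x)$, the supremum over all positive integers $x$.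
   Formalization: The formal statement adds the assumption r_n ≤ b_n when b_n > 1 (a day's rent never exceeds the buying price); without it the claim fails, e.g. n=2, r=(1,3), b=(1000,2), where the algorithm's ratio is 3, not 5/2, and buying on day 1 at shop 2 gives 2. *)

theory Defs
  imports Complex_Main "HOL-Library.Extended_Nat" "HOL-Library.Extended_Real"
begin

text \<open>
  Shops are numbered \<open>1, \<dots>, n\<close>; \<open>r j\<close> and \<open>b j\<close> are the renting and the buying price of shop \<open>j\<close>.
  A deterministic online algorithm is a pair \<open>(j, d)\<close> of a shop and a buying day, where the day
  \<open>\<infinity>\<close> means that the skier never buys.
\<close>

definition mssr_algorithms :: "nat \<Rightarrow> (nat \<times> enat) set" where
  "mssr_algorithms n = {1..n} \<times> {1..}"

text \<open>In the second branch \<open>d \<le> x\<close>, so \<open>d\<close> is finite and \<open>the_enat d\<close> is its value.\<close>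

definition alg_cost :: "(nat \<Rightarrow> real) \<Rightarrow> (nat \<Rightarrow> real) \<Rightarrow> nat \<times> enat \<Rightarrow> nat \<Rightarrow> real" where
  "alg_cost r b = (\<lambda>(j, d) x.
     if enat x < d then real x * r j else (real (the_enat d) - 1) * r j + b j)"

definition opt_cost :: "nat \<Rightarrow> (nat \<Rightarrow> real) \<Rightarrow> nat \<Rightarrow> real" where
  "opt_cost n b x = min (real x) (b n)"

text \<open>The supremum is taken in the extended reals: it is infinite if the skier never buys.\<close>

definition competitive_ratio ::
  "nat \<Rightarrow> (nat \<Rightarrow> real) \<Rightarrow> (nat \<Rightarrow> real) \<Rightarrow> nat \<times> enat \<Rightarrow> ereal" where
  "competitive_ratio n r b A = (SUP x\<in>{1::nat..}. ereal (alg_cost r b A x / opt_cost n b x))"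

end

theory Submission
  imports Defs
begin

text \<open>
  Write \<open>m = b n\<close>. If the skier buys at shop \<open>j\<close> on day \<open>d\<close>, then the adversary stops skiing on
  day \<open>d\<close>: for \<open>d \<ge> m\<close> the ratio is \<open>((d - 1) r\<^sub>j + b\<^sub>j) / m\<close>, which increases in \<open>d\<close>; for \<open>d \<le> m\<close>
  it is \<open>r\<^sub>j + (b\<^sub>j - r\<^sub>j) / d\<close>, which decreases in \<open>d\<close> because \<open>r\<^sub>j \<le> b\<^sub>j\<close>. So \<open>d = m\<close> is the best
  day in every shop. On that day the ratio is \<open>r\<^sub>j\<close> before buying and \<open>r\<^sub>j + (b\<^sub>j - r\<^sub>j) / m\<close>
  afterwards, and the best shop minimises the latter.
\<close>

lemma competitive_ratio_upper:
  assumes "x \<ge> 1"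
  shows "ereal (alg_cost r b A x / opt_cost n b x) \<le> competitive_ratio n r b A"
  using assms unfolding competitive_ratio_def by (intro SUP_upper) auto

text \<open>Before day \<open>m\<close> the optimum also rents, at price 1, so the ratio is
  \<open>r j\<close>; from day \<open>m\<close> on both costs are constant. \<open>buy\<close> makes
  the later ratio the larger one. It is guarded because for \<open>m = 1\<close> no day precedes the
  purchase.\<close>

lemma competitive_ratio_buy_at_opt:
  assumes m: "b n = real m" "m \<ge> 1" and buy: "m > 1 \<Longrightarrow> r j \<le> b j"
  shows "competitive_ratio n r b (j, enat m) = ereal (r j + (b j - r j) / b n)"
proof (rule antisym)
  have "alg_cost r b (j, enat m) x / opt_cost n b x \<le> r j + (b j - r j) / b n" if "x \<ge> 1" for x
  proof (cases "x < m")
    case True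
    with that buy m show ?thesis
      by (simp add: alg_cost_def opt_cost_def)
  next
    case False
    with m show ?thesis
      by (simp add: alg_cost_def opt_cost_def field_simps)
  qed
  then show "competitive_ratio n r b (j, enat m) \<le> ereal (r j + (b j - r j) / b n)"
    unfolding competitive_ratio_def by (intro SUP_least) auto
  \<comment> \<open>The supremum is attained on the buying day itself.\<close>
  have "alg_cost r b (j, enat m) m / opt_cost n b m = r j + (b j - r j) / b n"
    using m by (simp add: alg_cost_def opt_cost_def field_simps)
  with competitive_ratio_upper[OF m(2)]
  show "ereal (r j + (b j - r j) / b n) \<le> competitive_ratio n r b (j, enat m)"
    by metis
qed

lemma competitive_ratio_ge:
  assumes m: "b n = real m" "m \<ge> 1" and buy: "m > 1 \<Longrightarrow> r j \<le> b j"
    and r: "r j \<ge> 1" and d: "d \<ge> 1"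
  shows "ereal (r j + (b j - r j) / b n) \<le> competitive_ratio n r b (j, d)"
proof -
  have "\<exists>x\<ge>1. r j + (b j - r j) / b n \<le> alg_cost r b (j, d) x / opt_cost n b x"
  proof (cases d)
    case infinity
    \<comment> \<open>Without a purchase, one late day suffices: since \<open>r j \<ge> 1\<close>,
      at least \<open>b j\<close> days of rent beyond day \<open>m\<close> cost no less than buying.
      For \<open>m = 1\<close> the sign of \<open>b j\<close> is unknown, hence the case split
      below.\<close>
    define x where "x = m + nat \<lceil>b j\<rceil>"
    have x: "real x \<ge> real m + b j" "x \<ge> m"
      unfolding x_def by linarith+
    have "real m * r j + b j \<le> real x * r j"
    proof (cases "b j \<ge> 0")
      case True
      have "(real m + b j) * r j \<le> real x * r j"
        using x r by (intro mult_right_mono) auto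
      moreover have "b j * 1 \<le> b j * r j"
        using True r by (intro mult_left_mono) auto
      ultimately show ?thesis by (simp add: algebra_simps)
    next
      case False
      moreover have "real m * r j \<le> real x * r j"
        using x r by (intro mult_right_mono) auto
      ultimately show ?thesis by simp
    qed
    then have "((real m - 1) * r j + b j) / real m \<le> real x * r j / real m"
      using r by (intro divide_right_mono) (auto simp: algebra_simps)
    moreover have "r j + (b j - r j) / b n = ((real m - 1) * r j + b j) / real m"
      using m by (simp add: field_simps)
    ultimately have "r j + (b j - r j) / b n \<le> alg_cost r b (j, d) x / opt_cost n b x"
      using m x infinity by (simp add: alg_cost_def opt_cost_def)
    with m x show ?thesis by (intro exI[of _ x]) auto
  next
    case (enat k)
    with d have k: "k \<ge> 1" by (simp add: one_enat_def)
    have "r j + (b j - r j) / b n \<le> alg_cost r b (j, d) k / opt_cost n b k"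
    proof (cases "m \<le> k")
      case True
      have "real m * r j \<le> real k * r j"
        using True r by (intro mult_right_mono) auto
      with True m enat show ?thesis
        by (simp add: alg_cost_def opt_cost_def field_simps)
    next
      case False
      \<comment> \<open>Here \<open>1 \<le> k < m\<close>, so \<open>m > 1\<close> and
        \<open>buy\<close> makes the numerator nonnegative.\<close>
      have "(b j - r j) / real m \<le> (b j - r j) / real k"
        using False k buy by (intro divide_left_mono) auto
      moreover have "alg_cost r b (j, d) k / opt_cost n b k = r j + (b j - r j) / real k"
        using False k m enat by (simp add: alg_cost_def opt_cost_def field_simps)
      ultimately show ?thesis using m by simp
    qed
    with k show ?thesis by blast
  qed
  then show ?thesis
    by (metis competitive_ratio_upper ereal_less_eq(3) order_trans)
qed

text \<open>\<open>rent_le_buy\<close> excludes cases such as \<open>r 2 = 10\<close>,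
  \<open>b 2 = 2\<close>, \<open>b 1 = 100\<close> with \<open>n = 2\<close>: shop 2 minimises the
  formula with value 6, but renting there on day 1 already gives ratio 10, while buying at once
  gives 2.\<close>

theorem lemma1:
  fixes n i :: nat and r b :: "nat \<Rightarrow> real"
  assumes "n \<ge> 1"
    and "r 1 = 1" and "strict_mono_on {1..n} r"
    and "strict_antimono_on {1..n} b" and "b n > 0" and "b n \<in> \<int>"
    and rent_le_buy: "b n > 1 \<Longrightarrow> r n \<le> b n"
    and "is_arg_min (\<lambda>j. r j + (b j - r j) / b n) (\<lambda>j. j \<in> {1..n}) i"
  shows "is_arg_min (competitive_ratio n r b) (\<lambda>A. A \<in> mssr_algorithms n)
           (i, enat (nat \<lfloor>b n\<rfloor>))
       \<and> competitive_ratio n r b (i, enat (nat \<lfloor>b n\<rfloor>)) = ereal (r i + (b i - r i) / b n)"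
proof -
  define m where "m = nat \<lfloor>b n\<rfloor>"
  have m: "b n = real m" "m \<ge> 1"
    using \<open>b n > 0\<close> \<open>b n \<in> \<int>\<close> by (auto simp: m_def elim!: Ints_cases)
  have r_mono: "r j \<le> r k" if "1 \<le> j" "j \<le> k" "k \<le> n" for j k
    using strict_mono_onD[OF \<open>strict_mono_on {1..n} r\<close>, of j k] that
    by (cases "j = k") auto
  have b_ge: "b n \<le> b j" if "j \<in> {1..n}" for j
    using monotone_onD[OF \<open>strict_antimono_on {1..n} b\<close>, of j n] that
    by (cases "j = n") auto
  have r_ge: "1 \<le> r j" if "j \<in> {1..n}" for j
    using r_mono[of 1 j] that \<open>r 1 = 1\<close> by auto
  \<comment> \<open>Shop \<open>n\<close> is the extreme case:
    \<open>r j \<le> r n \<le> b n \<le> b j\<close>.\<close>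
  have buy: "r j \<le> b j" if "j \<in> {1..n}" "m > 1" for j
    using r_mono[of j n] b_ge[of j] rent_le_buy that m by auto
  have i: "i \<in> {1..n}"
    using assms(8) by (simp add: is_arg_min_def)
  have i_min: "r i + (b i - r i) / b n \<le> r j + (b j - r j) / b n" if "j \<in> {1..n}" for j
    using assms(8) that by (simp add: is_arg_min_linorder)
  have eq: "competitive_ratio n r b (i, enat m) = ereal (r i + (b i - r i) / b n)"
    using m buy i by (intro competitive_ratio_buy_at_opt) auto
  have "competitive_ratio n r b (i, enat m) \<le> competitive_ratio n r b A"
    if A_in: "A \<in> mssr_algorithms n" for A
  proof -
    obtain j d where A: "A = (j, d)" "j \<in> {1..n}" "d \<ge> 1"
      using A_in by (auto simp: mssr_algorithms_def)
    have "ereal (r j + (b j - r j) / b n) \<le> competitive_ratio n r b (j, d)"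
      using m buy r_ge A by (intro competitive_ratio_ge) auto
    with i_min[OF A(2)] show ?thesis
      unfolding eq A(1) by (meson ereal_less_eq(3) order_trans)
  qed
  moreover have "(i, enat m) \<in> mssr_algorithms n"
    using i m by (auto simp: mssr_algorithms_def one_enat_def)
  ultimately show ?thesis
    using eq by (auto simp: is_arg_min_linorder m_def)
qed

end
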